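(* Let $f_1$ and $f_2$ be two functions of class $\mathcal{P}$ (defined in the context), and consider $f_1(x+t)$ and $f_2(x+t)$ as functions of $x\in\mathbb{R}$ parameterized by $t\in\mathbb{R}$. Then the sum function $$s(x+t)=f_1(x+t)+f_2(x+t)$$ is again a continuous, nondecreasing, piecewise linear function of $x$, parameterized by $t$, of the same type; that is, $s=f_1+f_2$ is of class $\mathcal{P}$.
   Context: A function $f:\mathbb{R}\to\mathbb{R}$ is of class $\mathcal{P}$ if it is continuous, nondecreasing and piecewise linear with a finite number $M\ge1$ of changes of slope, at abscissae $\gamma_1<\gamma_2<\dots<\gamma_M$, having slope $\mu_0$ on $(-\infty,\gamma_1)$, $\mu_i$ on $[\gamma_i,\gamma_{i+1})$ for $i=1,\dots,M-1$, and $\mu_M$ on $[\gamma_M,+\infty)$, with $\mu_{i+1}\ne\mu_i$ for all $i=0,\dots,M-1$, and if moreover $f(x)=0$ for every $x\le\gamma_1$ (so $\mu_0=0$). For such $f$ and a real parameter $t$, $f(x+t)$ is viewed as a function of $x$ (the translate of $f$, with breakpoints $\gamma_i-t$). *)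

theory Defs
  imports Complex_Main
begin

definition has_slope_on :: "(real \<Rightarrow> real) \<Rightarrow> real \<Rightarrow> real set \<Rightarrow> bool"
  where "has_slope_on f m I \<longleftrightarrow> (\<exists>c. \<forall>x\<in>I. f x = m * x + c)"

(* Only the values g 1, ..., g M and m 0, ..., m M are relevant.
   That m 0 = 0 follows from the last conjunct. *)
definition class_P :: "(real \<Rightarrow> real) \<Rightarrow> bool"
  where "class_P f \<longleftrightarrow>
    continuous_on UNIV f \<and> mono f \<and>
    (\<exists>(M::nat) (g::nat \<Rightarrow> real) (m::nat \<Rightarrow> real).
       M \<ge> 1 \<and>
       strict_mono_on {1..M} g \<and>
       has_slope_on f (m 0) {..<g 1} \<and>
       (\<forall>i\<in>{1..<M}. has_slope_on f (m i) {g i..<g (i + 1)}) \<and>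
       has_slope_on f (m M) {g M..} \<and>
       (\<forall>i<M. m (i + 1) \<noteq> m i) \<and>
       (\<forall>x\<le>g 1. f x = 0))"

end

(* A class P function is the same as a nonzero nondecreasing finite linear combination of hinges
   x \<mapsto> max 0 (x - s): the coefficient at a breakpoint is the jump of the slope there.
   Linear combinations of hinges are visibly closed under addition and translation. The sum does
   not degenerate to the zero function because both summands are nonnegative. *)

theory Submission imports Defs begin

text \<open>Coefficients may vanish and \<open>S\<close> may be empty, so sums can be formed without
  tracking which breakpoints cancel. Indexing by the breakpoints themselves lets two families be
  merged over a union.\<close>

definition hinge_combination :: "(real \<Rightarrow> real) \<Rightarrow> bool"
  where "hinge_combination f \<longleftrightarrow>
    (\<exists>S c. finite S \<and> (\<forall>x. f x = (\<Sum>s\<in>S. c s * max 0 (x - s))))"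

lemma hinge_combination_add:
  assumes "hinge_combination f" "hinge_combination g"
  shows "hinge_combination (\<lambda>x. f x + g x)"
proof -
  obtain S c where S: "finite S" "\<And>x. f x = (\<Sum>s\<in>S. c s * max 0 (x - s))"
    using assms(1) unfolding hinge_combination_def by blast
  obtain T d where T: "finite T" "\<And>x. g x = (\<Sum>s\<in>T. d s * max 0 (x - s))"
    using assms(2) unfolding hinge_combination_def by blast
  \<comment> \<open>Both coefficient families are extended by zero to \<open>S \<union> T\<close>;
    at a common breakpoint they add up, possibly to zero.\<close>
  define e where "e s = (if s \<in> S then c s else 0) + (if s \<in> T then d s else 0)" for s
  have "f x + g x = (\<Sum>s\<in>S \<union> T. e s * max 0 (x - s))" for x
  proof -
    have "f x = (\<Sum>s\<in>S \<union> T. (if s \<in> S then c s else 0) * max 0 (x - s))"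
      unfolding S(2) using S(1) T(1) by (intro sum.mono_neutral_cong_left) auto
    moreover have "g x = (\<Sum>s\<in>S \<union> T. (if s \<in> T then d s else 0) * max 0 (x - s))"
      unfolding T(2) using S(1) T(1) by (intro sum.mono_neutral_cong_left) auto
    ultimately show ?thesis
      by (simp add: e_def distrib_right sum.distrib)
  qed
  then show ?thesis
    unfolding hinge_combination_def using S(1) T(1) by blast
qed

lemma hinge_combination_translate:
  assumes "hinge_combination f"
  shows "hinge_combination (\<lambda>x. f (x + t))"
proof -
  obtain S c where S: "finite S" "\<And>x. f x = (\<Sum>s\<in>S. c s * max 0 (x - s))"
    using assms unfolding hinge_combination_def by blast
  \<comment> \<open>Since \<open>x + t - s = x - (s - t)\<close>, each breakpoint moves left by
    \<open>t\<close> and keeps its coefficient.\<close>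
  have "f (x + t) = (\<Sum>s\<in>(\<lambda>s. s - t) ` S. c (s + t) * max 0 (x - s))" for x
    unfolding S(2) by (subst sum.reindex) (auto simp: inj_on_def algebra_simps)
  then show ?thesis
    unfolding hinge_combination_def using S(1)
    by (intro exI[of _ "(\<lambda>s. s - t) ` S"] exI[of _ "\<lambda>s. c (s + t)"]) auto
qed

text \<open>The slope condition is silent about \<open>b\<close>; continuity carries the affine
  formula there as a left limit. The closed interval makes adjacent pieces share an
  endpoint.\<close>

lemma continuous_slope_closed:
  assumes f: "continuous_on UNIV f" and "has_slope_on f m {a..<b}" and x: "a \<le> x" "x \<le> b"
  shows "f x = f a + m * (x - a)"
proof (cases "a < b")
  case True
  obtain c where c: "\<And>y. y \<in> {a..<b} \<Longrightarrow> f y = m * y + c"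
    using assms(2) unfolding has_slope_on_def by blast
  have "f b = m * b + c"
  proof (rule tendsto_unique[OF trivial_limit_at_left_real])
    show "(f \<longlongrightarrow> f b) (at_left b)"
      using f by (auto simp: continuous_on_def intro: tendsto_within_subset)
    have "\<forall>\<^sub>F y in at_left b. m * y + c = f y"
      using eventually_at_left_real[OF True] by eventually_elim (auto simp: c)
    then show "(f \<longlongrightarrow> m * b + c) (at_left b)"
      by (rule Lim_transform_eventually[rotated]) (intro tendsto_intros)
  qed
  then have "f x = m * x + c"
    using c[of x] x by (cases "x = b") auto
  then show ?thesis
    using c[of a] True by (simp add: algebra_simps)
next
  case False
  then have "x = a" using x by simp
  then show ?thesis by simp
qed

lemma class_PE:
  assumes "class_P f"
  obtains M :: nat and g m where
    "continuous_on UNIV f" "mono f" "M \<ge> 1" "strict_mono_on {1..M} g"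
    "has_slope_on f (m 0) {..<g 1}"
    "\<forall>i\<in>{1..<M}. has_slope_on f (m i) {g i..<g (i + 1)}"
    "has_slope_on f (m M) {g M..}"
    "\<forall>i<M. m (i + 1) \<noteq> m i"
    "\<forall>x\<le>g 1. f x = 0"
  using assms unfolding class_P_def
  by (elim conjE exE) (rule that)

text \<open>The coefficient at \<open>g i\<close> is the slope jump \<open>m i - m (i - 1)\<close>.
  The partial sums \<open>H k\<close> of these hinges are matched with \<open>f\<close> piece by
  piece, from left to right.\<close>

lemma class_P_imp_hinge_combination:
  assumes "class_P f"
  shows "hinge_combination f"
proof -
  obtain M :: nat and g m where cont: "continuous_on UNIV f" and "mono f" and M: "M \<ge> 1"
    and g: "strict_mono_on {1..M} g" and left: "has_slope_on f (m 0) {..<g 1}"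
    and mid [rule_format]: "\<forall>i\<in>{1..<M}. has_slope_on f (m i) {g i..<g (i + 1)}"
    and right: "has_slope_on f (m M) {g M..}"
    and ne [rule_format]: "\<forall>i<M. m (i + 1) \<noteq> m i"
    and zero [rule_format]: "\<forall>x\<le>g 1. f x = 0"
    by (rule class_PE[OF assms])
  obtain c0 where c0: "\<And>x. x < g 1 \<Longrightarrow> f x = m 0 * x + c0"
    using left unfolding has_slope_on_def by auto
  have m0: "m 0 = 0"
    using c0[of "g 1 - 1"] c0[of "g 1 - 2"] zero[of "g 1 - 1"] zero[of "g 1 - 2"]
    by (simp add: algebra_simps)
  define H where "H k x = (\<Sum>i=1..k. (m i - m (i - 1)) * max 0 (x - g i))" for k :: nat and x
  have g_le: "g i \<le> g j" if "1 \<le> i" "i \<le> j" "j \<le> M" for i j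
    using that strict_mono_onD[OF g, of i j] by (cases "i = j") auto
  have H_right: "H k x = H k (g k) + m k * (x - g k)" if "k \<ge> 1" "k \<le> M" "g k \<le> x" for k x
  proof -
    \<comment> \<open>From \<open>g k\<close> on, the first \<open>k\<close> hinges are all in their
      linear regime, so each grows by exactly \<open>x - g k\<close>.\<close>
    have "H k x - H k (g k) = (\<Sum>i=1..k. (m i - m (i - 1)) * (x - g k))"
      unfolding H_def sum_subtractf[symmetric]
    proof (intro sum.cong refl)
      fix i assume "i \<in> {1..k}"
      then show "(m i - m (i - 1)) * max 0 (x - g i) - (m i - m (i - 1)) * max 0 (g k - g i)
          = (m i - m (i - 1)) * (x - g k)"
        using g_le[of i k] that by (simp add: max_def algebra_simps)
    qed
    also have "\<dots> = (\<Sum>i=1..k. m i - m (i - 1)) * (x - g k)"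
      by (rule sum_distrib_right[symmetric])
    \<comment> \<open>The jumps telescope to \<open>m k - m 0\<close>, and
      \<open>m 0 = 0\<close>.\<close>
    also have "(\<Sum>i=1..k. m i - m (i - 1)) = m k"
      using m0 by (induction k) auto
    finally show ?thesis by simp
  qed
  \<comment> \<open>The hinge added at \<open>g (Suc k)\<close> is still zero up to and including
    its breakpoint.\<close>
  have H_Suc: "H (Suc k) x = H k x" if "x \<le> g (Suc k)" for k x
    using that by (simp add: H_def max_def)
  have f_H: "f x = H k x" if "k < M" "x \<le> g (Suc k)" for k x
    using that
  proof (induction k arbitrary: x)
    case 0
    then show ?case using zero by (simp add: H_def)
  next
    case (Suc k)
    show ?case
    proof (cases "x \<le> g (Suc k)")
      case True
      then show ?thesis using Suc H_Suc by simp
    next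
      case False
      \<comment> \<open>On the new piece \<open>f\<close> and \<open>H (Suc k)\<close> have the same
        slope; the induction hypothesis supplies equality at its left endpoint.\<close>
      have "f x = f (g (Suc k)) + m (Suc k) * (x - g (Suc k))"
        using Suc.prems False mid[of "Suc k"] by (intro continuous_slope_closed[OF cont]) auto
      also have "f (g (Suc k)) = H (Suc k) (g (Suc k))"
        using Suc H_Suc by simp
      also have "\<dots> + m (Suc k) * (x - g (Suc k)) = H (Suc k) x"
        using H_right[of "Suc k" x] False Suc.prems by simp
      finally show ?thesis .
    qed
  qed
  \<comment> \<open>The last piece is unbounded and has no next breakpoint, so it lies outside the
    induction.\<close>
  have f_HM: "f x = H M x" for x
  proof (cases "x \<le> g M")
    case True
    then show ?thesis using f_H[of "M - 1" x] H_Suc[of x "M - 1"] M by simp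
  next
    case False
    obtain c where c: "\<And>y. g M \<le> y \<Longrightarrow> f y = m M * y + c"
      using right unfolding has_slope_on_def by auto
    have "f x = f (g M) + m M * (x - g M)"
      using c[of x] c[of "g M"] False by (simp add: algebra_simps)
    also have "f (g M) = H M (g M)"
      using f_H[of "M - 1" "g M"] H_Suc[of "g M" "M - 1"] M by simp
    finally show ?thesis
      using H_right[of M x] False M by simp
  qed
  have inj: "inj_on g {1..M}"
    using g by (rule strict_mono_on_imp_inj_on)
  \<comment> \<open>\<open>H\<close> is indexed by position, a hinge combination by breakpoint;
    injectivity of \<open>g\<close> allows the position to be recovered.\<close>
  define c where "c s = (let i = the_inv_into {1..M} g s in m i - m (i - 1))" for s
  have "f x = (\<Sum>s\<in>g ` {1..M}. c s * max 0 (x - s))" for x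
    unfolding sum.reindex[OF inj] f_HM H_def
    by (intro sum.cong refl) (simp add: c_def the_inv_into_f_f[OF inj] del: One_nat_def)
  then show ?thesis
    unfolding hinge_combination_def by blast
qed

text \<open>For the zero function the slopes on both sides of \<open>g 1\<close> would be 0,
  contradicting \<open>m 1 \<noteq> m 0\<close>.\<close>

lemma class_P_nonzero:
  assumes "class_P f"
  shows "\<exists>x. f x \<noteq> 0"
proof (rule ccontr)
  assume "\<not> (\<exists>x. f x \<noteq> 0)"
  then have f: "f x = 0" for x by blast
  obtain M :: nat and g m where "continuous_on UNIV f" and "mono f" and M: "M \<ge> 1"
    and g: "strict_mono_on {1..M} g" and left: "has_slope_on f (m 0) {..<g 1}"
    and mid [rule_format]: "\<forall>i\<in>{1..<M}. has_slope_on f (m i) {g i..<g (i + 1)}"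
    and right: "has_slope_on f (m M) {g M..}"
    and ne [rule_format]: "\<forall>i<M. m (i + 1) \<noteq> m i"
    and "\<forall>x\<le>g 1. f x = 0"
    by (rule class_PE[OF assms])
  have slope0: "a = 0" if slope: "has_slope_on f a I" and xy: "x \<in> I" "y \<in> I" "x \<noteq> y" for a I x y
  proof -
    obtain c where c: "\<And>x. x \<in> I \<Longrightarrow> 0 = a * x + c"
      using slope unfolding has_slope_on_def f by blast
    have "a * (x - y) = 0" using c[OF xy(1)] c[OF xy(2)] by (simp only: right_diff_distrib)
    then show ?thesis using xy(3) by simp
  qed
  have "m 0 = 0" using slope0[OF left, of "g 1 - 1" "g 1 - 2"] by simp
  \<comment> \<open>The piece to the right of \<open>g 1\<close> is a half-line if
    \<open>M = 1\<close>, and otherwise ends at \<open>g 2\<close>.\<close>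
  moreover have "m 1 = 0"
  proof (cases "M = 1")
    case True
    then show ?thesis using slope0[OF right, of "g 1" "g 1 + 1"] by simp
  next
    case False
    then have "g 1 < g 2" using M by (intro strict_mono_onD[OF g]) auto
    then show ?thesis
      using slope0[OF mid[of 1], of "g 1" "(g 1 + g 2) / 2"] M False by (simp add: numeral_2_eq_2)
  qed
  ultimately show False using ne[of 0] M by simp
qed

lemma class_P_nonneg:
  assumes "class_P f"
  shows "f x \<ge> 0"
proof -
  obtain a where "\<forall>y\<le>a. f y = 0" and "mono f"
    using assms by (rule class_PE) (rule that)
  then show ?thesis
    using monoD[of f "min a x" x] by simp
qed

text \<open>Sorting the breakpoints with nonzero coefficient gives the pieces; the slope after the
  first \<open>k\<close> of them is the sum of their coefficients. The point \<open>z\<close>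
  ensures that at least one breakpoint survives.\<close>

lemma class_PI:
  assumes "mono f" and "f z \<noteq> 0" and "hinge_combination f"
  shows "class_P f"
proof -
  obtain S0 c where S0: "finite S0" "\<And>x. f x = (\<Sum>s\<in>S0. c s * max 0 (x - s))"
    using assms(3) unfolding hinge_combination_def by blast
  define S where "S = {s \<in> S0. c s \<noteq> 0}"
  have "finite S" using S0(1) by (simp add: S_def)
  have fS: "f x = (\<Sum>s\<in>S. c s * max 0 (x - s))" for x
    unfolding S0(2) S_def using S0(1) by (intro sum.mono_neutral_right) auto
  define M where "M = card S"
  have "S \<noteq> {}" using fS[of z] assms(2) by auto
  then have M: "M \<ge> 1"
    using \<open>finite S\<close> by (simp add: M_def Suc_le_eq card_gt_0_iff)
  define h where "h = (!) (sorted_list_of_set S)"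
  have h: "bij_betw h {..<M} S" "strict_mono_on {..<M} h"
  proof -
    show "bij_betw h {..<M} S"
      unfolding h_def by (rule bij_betw_nth) (simp_all add: M_def \<open>finite S\<close>)
    show "strict_mono_on {..<M} h"
      unfolding h_def
      by (rule strict_mono_onI) (simp add: M_def sorted_wrt_nth_less[OF strict_sorted_list_of_set])
  qed
  \<comment> \<open>List positions start at 0, the breakpoints of \<open>class_P\<close> at
    1.\<close>
  define g where "g i = h (i - 1)" for i
  have g: "strict_mono_on {1..M} g"
    unfolding g_def by (rule strict_mono_onI, rule strict_mono_onD[OF h(2)]) auto
  have "bij_betw (\<lambda>i. i - 1) {1..M} {..<M}"
    by (rule bij_betw_byWitness[where f' = Suc]) auto
  from bij_betw_trans[OF this h(1)] have g_bij: "bij_betw g {1..M} S"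
    by (simp add: g_def[abs_def] comp_def)
  have f_g: "f x = (\<Sum>i=1..M. c (g i) * max 0 (x - g i))" for x
    unfolding fS by (rule sum.reindex_bij_betw[OF g_bij, symmetric])
  define m where "m k = (\<Sum>i=1..k. c (g i))" for k
  have g_le: "g i \<le> g j" if "1 \<le> i" "i \<le> j" "j \<le> M" for i j
    using that strict_mono_onD[OF g, of i j] by (cases "i = j") auto
  \<comment> \<open>The guards drop the missing bound when \<open>k = 0\<close> or
    \<open>k = M\<close>, so one statement covers inner and outer pieces. Hinges up to
    \<open>k\<close> are linear at \<open>x\<close>, later ones vanish.\<close>
  have affine: "f x = m k * x - (\<Sum>i=1..k. c (g i) * g i)"
    if "k \<le> M" and below: "k \<ge> 1 \<Longrightarrow> g k \<le> x" and above: "k < M \<Longrightarrow> x \<le> g (k + 1)" for k x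
  proof -
    have "f x = (\<Sum>i=1..k. c (g i) * (x - g i))"
      unfolding f_g
    proof (rule sum.mono_neutral_cong_right)
      show "\<forall>i\<in>{1..M} - {1..k}. c (g i) * max 0 (x - g i) = 0"
      proof
        fix i assume "i \<in> {1..M} - {1..k}"
        then have "x \<le> g i" using above g_le[of "k + 1" i] by auto
        then show "c (g i) * max 0 (x - g i) = 0" by simp
      qed
      fix i assume "i \<in> {1..k}"
      then have "g i \<le> x" using below g_le[of i k] that(1) by auto
      then show "c (g i) * max 0 (x - g i) = c (g i) * (x - g i)" by simp
    qed (use that(1) in auto)
    then show ?thesis
      by (simp add: m_def sum_distrib_right right_diff_distrib sum_subtractf)
  qed
  have slope: "has_slope_on f (m k) I"
    if "k \<le> M" "\<And>x. x \<in> I \<Longrightarrow> k \<ge> 1 \<Longrightarrow> g k \<le> x" "\<And>x. x \<in> I \<Longrightarrow> k < M \<Longrightarrow> x \<le> g (k + 1)" for k I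
    unfolding has_slope_on_def
    by (rule exI[of _ "- (\<Sum>i=1..k. c (g i) * g i)"]) (use affine that in auto)
  have cont: "continuous_on UNIV f"
    unfolding f_g by (intro continuous_intros)
  have "c (g i) \<noteq> 0" if "i \<in> {1..M}" for i
    using bij_betwE[OF g_bij] that by (auto simp: S_def)
  \<comment> \<open>Consecutive slopes differ by the single coefficient
    \<open>c (g (i + 1))\<close>.\<close>
  then have ne: "m (i + 1) \<noteq> m i" if "i < M" for i
    using that by (simp add: m_def)
  show ?thesis
    unfolding class_P_def
  proof (intro conjI)
    show "\<exists>(M::nat) (g::nat \<Rightarrow> real) (m::nat \<Rightarrow> real). M \<ge> 1 \<and> strict_mono_on {1..M} g \<and> has_slope_on f (m 0) {..<g 1} \<and>
        (\<forall>i\<in>{1..<M}. has_slope_on f (m i) {g i..<g (i + 1)}) \<and> has_slope_on f (m M) {g M..} \<and>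
        (\<forall>i<M. m (i + 1) \<noteq> m i) \<and> (\<forall>x\<le>g 1. f x = 0)"
    proof (rule exI[of _ M], rule exI[of _ g], rule exI[of _ m], intro conjI)
      show "has_slope_on f (m 0) {..<g 1}" by (rule slope) auto
      show "\<forall>i\<in>{1..<M}. has_slope_on f (m i) {g i..<g (i + 1)}" by (auto intro!: slope)
      show "has_slope_on f (m M) {g M..}" by (rule slope) auto
      \<comment> \<open>For \<open>k = 0\<close> both sums in the affine formula are empty.\<close>
      show "\<forall>x\<le>g 1. f x = 0" using affine[of 0] by (simp add: m_def)
    qed (use M g ne in auto)
  qed (use assms(1) cont in auto)
qed

lemma class_P_add:
  assumes "class_P f" and "class_P g"
  shows "class_P (\<lambda>x. f x + g x)"
proof -
  obtain z where "f z \<noteq> 0" using class_P_nonzero[OF assms(1)] by blast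
  then have "f z + g z \<noteq> 0"
    using class_P_nonneg[OF assms(1), of z] class_P_nonneg[OF assms(2), of z] by simp
  moreover have "mono f" "mono g" using assms by (auto simp: class_P_def)
  then have "mono (\<lambda>x. f x + g x)" by (auto simp: mono_def intro: add_mono)
  moreover have "hinge_combination (\<lambda>x. f x + g x)"
    using hinge_combination_add[OF assms[THEN class_P_imp_hinge_combination]] .
  ultimately show ?thesis using class_PI[where f = "\<lambda>x. f x + g x"] by blast
qed

lemma class_P_translate:
  assumes "class_P f"
  shows "class_P (\<lambda>x. f (x + t))"
proof -
  obtain z where "f z \<noteq> 0" using class_P_nonzero[OF assms] by blast
  then have "f ((z - t) + t) \<noteq> 0" by simp
  moreover have "mono (\<lambda>x. f (x + t))"
    using assms by (auto simp: class_P_def mono_def)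
  moreover have "hinge_combination (\<lambda>x. f (x + t))"
    using hinge_combination_translate[OF class_P_imp_hinge_combination[OF assms]] .
  ultimately show ?thesis using class_PI[where f = "\<lambda>x. f (x + t)"] by blast
qed

theorem lemma3:
  fixes f1 f2 :: "real \<Rightarrow> real"
  assumes "class_P f1" and "class_P f2"
  shows "class_P (\<lambda>x. f1 x + f2 x) \<and>
         (\<forall>t::real. class_P (\<lambda>x. f1 (x + t) + f2 (x + t)))"
  using class_P_add[OF assms] class_P_translate[OF class_P_add[OF assms]] by simp

end
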